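(* Let $n_0\in\mathbb{Z}$, $D=\{(m,n)\in\mathbb{Z}^2 : n\le n_0\}$ and $\tilde D=\{(m,n)\in\mathbb{Z}^2: n>n_0\}$. Let $\tilde F:D\to\mathbb{R}^3$ be a discrete asymptotic minimal net with corresponding Gauss map $N$. Suppose that the discrete asymptotic line $m\mapsto\tilde F_{m,n_0}$ is a straight line $\ell$. Extend $\tilde F$ to $\mathbb{Z}^2=D\cup\tilde D$ so that the extension is symmetric with respect to the line $\ell$, i.e. $\tilde F_{m,n_0+k}$ is the image of $\tilde F_{m,n_0-k}$ under the rotation by $180$ degrees about $\ell$, for all $m\in\mathbb{Z}$ and $k\ge1$. Then the extension is a discrete asymptotic minimal net on $\mathbb{Z}^2$.
   Context: Notions are used for nets on $\mathbb{Z}^2$ or on subdomains of $\mathbb{Z}^2$ (such as $D$). An elementary quadrilateral $(ijkl)$ consists of the vertices $i=(m,n)$, $j=(m+1,n)$, $k=(m+1,n+1)$, $l=(m,n+1)$. A discrete asymptotic net is a map $\tilde F$ from the domain to $\mathbb{R}^3$ such that for every vertex $(m,n)$ the point $\tilde F_{m,n}$ and the images of its neighbouring vertices $(m\pm1,n),(m,n\pm1)$ (those in the domain) lie in a common plane $\mathcal{P}_{m,n}$ (the tangent plane). Discrete asymptotic nets are assumed non-degenerate: on every elementary quadrilateral, $\tilde F_i,\tilde F_j,\tilde F_k,\tilde F_l$ are not coplanar. The Gauss map $N$ of $\tilde F$ is the unit normal to $\mathcal{P}_{m,n}$. The discrete asymptotic lines are the discrete curves $m\mapsto\tilde F_{m,n_0}$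 and $n\mapsto\tilde F_{m_0,n}$. A discrete asymptotic minimal net is a discrete asymptotic net that is minimal in the sense of the discrete minimal edge-constraint nets of Hoffmann, Sageman-Furnas and Wardetzky ("A discrete parametrized surface theory in $\mathbb{R}^3$"). Recall: a net $\tilde F$ together with a map $N$ to the unit sphere $S^2$ is an edge-constraint net if $(\tilde F_q-\tilde F_p)\cdot(N_p+N_q)=0$ for every edge $pq$ (this holds for a discrete asymptotic net with its Gauss map, since each edge lies in the tangent planes at both of its endpoints). It is minimal if its mean curvature vanishes on every elementary quadrilateral, i.e. if the mixed area of $\tilde F$ and $N$ vanishes: $$\det(\tilde F_k-\tilde F_i,\,N_l-N_j,\,\nu)+\det(N_k-N_i,\,\tilde F_l-\tilde F_j,\,\nu)=0,$$ where $\nu$ is the unit vector in the direction of $(N_k-N_i)\times(N_l-N_j)$. *)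

theory Defs
  imports "HOL-Analysis.Analysis"
begin

unbundle cross3_syntax

text \<open>
  A net on a domain \<open>D\<close> is a total function on \<open>int \<times> int\<close>; its values outside \<open>D\<close> are never used.
\<close>

type_synonym net = "int \<times> int \<Rightarrow> real^3"

fun neighbours :: "int \<times> int \<Rightarrow> (int \<times> int) set" where
  "neighbours (m, n) = {(m + 1, n), (m - 1, n), (m, n + 1), (m, n - 1)}"

definition elementary_quad ::
  "(int \<times> int) set \<Rightarrow> int \<times> int \<Rightarrow> int \<times> int \<Rightarrow> int \<times> int \<Rightarrow> int \<times> int \<Rightarrow> bool" where
  "elementary_quad D i j k l \<longleftrightarrow>
     (\<exists>m n. i = (m, n) \<and> j = (m + 1, n) \<and> k = (m + 1, n + 1) \<and> l = (m, n + 1)) \<and>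
     {i, j, k, l} \<subseteq> D"

definition tangent_plane :: "(int \<times> int) set \<Rightarrow> net \<Rightarrow> int \<times> int \<Rightarrow> (real^3) set \<Rightarrow> bool" where
  "tangent_plane D F p P \<longleftrightarrow>
     affine P \<and> aff_dim P = 2 \<and> F ` ({p} \<union> neighbours p \<inter> D) \<subseteq> P"

definition asymptotic_net :: "(int \<times> int) set \<Rightarrow> net \<Rightarrow> bool" where
  "asymptotic_net D F \<longleftrightarrow>
     (\<forall>p\<in>D. \<exists>P. tangent_plane D F p P) \<and>
     (\<forall>i j k l. elementary_quad D i j k l \<longrightarrow> \<not> coplanar {F i, F j, F k, F l})"

text \<open>
  The sign of the unit normal is not determined by the net, so a Gauss map is a choice of one of
  the two unit normals at every vertex.
\<close>

definition gauss_map :: "(int \<times> int) set \<Rightarrow> net \<Rightarrow> net \<Rightarrow> bool" where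
  "gauss_map D F N \<longleftrightarrow>
     (\<forall>p\<in>D. norm (N p) = 1 \<and>
        (\<exists>P. tangent_plane D F p P \<and> (\<forall>x\<in>P. \<forall>y\<in>P. N p \<bullet> (x - y) = 0)))"

definition edge_constraint_net :: "(int \<times> int) set \<Rightarrow> net \<Rightarrow> net \<Rightarrow> bool" where
  "edge_constraint_net D F N \<longleftrightarrow>
     (\<forall>p\<in>D. norm (N p) = 1) \<and>
     (\<forall>p\<in>D. \<forall>q\<in>neighbours p \<inter> D. (F q - F p) \<bullet> (N p + N q) = 0)"

definition mixed_area ::
  "net \<Rightarrow> net \<Rightarrow> real^3 \<Rightarrow> int \<times> int \<Rightarrow> int \<times> int \<Rightarrow> int \<times> int \<Rightarrow> int \<times> int \<Rightarrow> real" where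
  "mixed_area F N \<nu> i j k l =
     det (vector [F k - F i, N l - N j, \<nu>] :: real^3^3) +
     det (vector [N k - N i, F l - F j, \<nu>] :: real^3^3)"

text \<open>
  The projection direction \<open>\<nu>\<close> is a unit vector only if the cross product is nonzero, so this is
  part of the definition; otherwise \<open>sgn 0 = 0\<close> would make the mixed area vanish trivially.
\<close>

definition minimal_edge_constraint_net :: "(int \<times> int) set \<Rightarrow> net \<Rightarrow> net \<Rightarrow> bool" where
  "minimal_edge_constraint_net D F N \<longleftrightarrow>
     edge_constraint_net D F N \<and>
     (\<forall>i j k l. elementary_quad D i j k l \<longrightarrow>
        (N k - N i) \<times> (N l - N j) \<noteq> 0 \<and>
        mixed_area F N (sgn ((N k - N i) \<times> (N l - N j))) i j k l = 0)"

definition asymptotic_minimal_net :: "(int \<times> int) set \<Rightarrow> net \<Rightarrow> net \<Rightarrow> bool" where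
  "asymptotic_minimal_net D F N \<longleftrightarrow>
     asymptotic_net D F \<and> gauss_map D F N \<and> minimal_edge_constraint_net D F N"

text \<open>
  Rodrigues' formula for the rotation by the angle \<open>\<theta>\<close> about the axis through \<open>a\<close> with unit
  direction \<open>u\<close>.
\<close>

definition rotation_about :: "real^3 \<Rightarrow> real^3 \<Rightarrow> real \<Rightarrow> real^3 \<Rightarrow> real^3" where
  "rotation_about a u \<theta> x =
     a + cos \<theta> *\<^sub>R (x - a) + sin \<theta> *\<^sub>R (u \<times> (x - a)) + ((1 - cos \<theta>) * (u \<bullet> (x - a))) *\<^sub>R u"

end

theory Submission imports Defs begin

text \<open>
  Let \<open>R\<close> be the half-turn about \<open>\<ell>\<close> and \<open>L\<close> its linear part. Non-degeneracy forces
  consecutive points of the boundary row to be distinct, so every tangent plane along that row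
  contains \<open>\<ell>\<close>: it is therefore \<open>R\<close>-invariant, and its normal satisfies \<open>L N = - N\<close>.
  Hence \<open>- L N\<close>, transported by the reflection \<open>n \<mapsto> 2 n0 - n\<close> of the index lattice,
  is a Gauss map that agrees with \<open>N\<close> on the boundary row. The reflection reverses the
  orientation of the elementary quadrilaterals, which interchanges the two diagonals, and \<open>L\<close>
  is a rotation, so the mixed area merely changes sign.
\<close>

section \<open>Linear algebra of the half-turn\<close>

text \<open>For a unit vector \<open>u\<close> this is twice the orthogonal projection onto the span
  of \<open>u\<close> minus the identity: it fixes \<open>u\<close> and negates the orthogonal
  complement. It is what Rodrigues' formula leaves when the cosine is -1 and the sine is 0.\<close>

definition half_turn :: "real^3 \<Rightarrow> real^3 \<Rightarrow> real^3" where
  "half_turn u v = (2 * (u \<bullet> v)) *\<^sub>R u - v"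

lemma rotation_about_pi: "rotation_about a u pi x = a + half_turn u (x - a)"
  by (simp add: rotation_about_def half_turn_def algebra_simps)

lemma rotation_about_pi_diff:
  "rotation_about a u pi x - rotation_about a u pi y = half_turn u (x - y)"
  by (simp add: rotation_about_pi half_turn_def algebra_simps inner_diff_right)

lemma linear_half_turn: "linear (half_turn u)"
  by (rule linearI) (simp_all add: half_turn_def inner_right_distrib algebra_simps)

lemma half_turn_inner:
  assumes "norm u = 1"
  shows "half_turn u v \<bullet> half_turn u w = v \<bullet> w"
proof -
  have "u \<bullet> u = 1" using assms by (simp add: norm_eq_1)
  then show ?thesis
    by (simp add: half_turn_def inner_diff_left inner_diff_right inner_commute algebra_simps)
qed

lemma half_turn_norm:
  assumes "norm u = 1"
  shows "norm (half_turn u v) = norm v"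
  using half_turn_inner[OF assms, of v v] by (simp add: norm_eq_sqrt_inner)

lemma inj_half_turn:
  assumes "norm u = 1"
  shows "inj (half_turn u)"
  by (metis assms half_turn_norm linear_half_turn linear_injective_0 norm_eq_zero)

text \<open>A half-turn is orthogonal with determinant 1, so it respects the cross product; a
  reflection would introduce a sign. The invariance of \<open>det\<close> and the behaviour of the
  projection direction both rest on this.\<close>

lemma half_turn_cross:
  assumes "norm u = 1"
  shows "half_turn u x \<times> half_turn u y = half_turn u (x \<times> y)"
proof -
  \<comment> \<open>A polynomial identity, checked by coordinates. For unit \<open>u\<close> it is
    exactly what turns the expanded product of the two images into
    \<open>half_turn u (x \<times> y)\<close>; the term quadratic in \<open>u\<close> drops out
    because \<open>u \<times> u = 0\<close>.\<close>
  have "(u \<bullet> u) *\<^sub>R (x \<times> y)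
      = (u \<bullet> x) *\<^sub>R (u \<times> y) + (u \<bullet> y) *\<^sub>R (x \<times> u) + (u \<bullet> (x \<times> y)) *\<^sub>R u"
    by (simp add: cross3_simps forall_3)
  moreover have "u \<bullet> u = 1" using assms by (simp add: norm_eq_1)
  ultimately have *: "x \<times> y
      = (u \<bullet> x) *\<^sub>R (u \<times> y) + (u \<bullet> y) *\<^sub>R (x \<times> u) + (u \<bullet> (x \<times> y)) *\<^sub>R u"
    by simp
  have "half_turn u x \<times> half_turn u y
      = x \<times> y - (2 * (u \<bullet> x)) *\<^sub>R (u \<times> y) - (2 * (u \<bullet> y)) *\<^sub>R (x \<times> u)"
    by (simp add: half_turn_def Cross3.left_diff_distrib Cross3.right_diff_distrib
        cross_mult_left cross_mult_right)
  also have "\<dots> = half_turn u (x \<times> y)"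
  proof (rule vec_eq_iff[THEN iffD2, rule_format])
    fix i
    have "(x \<times> y) $ i = (u \<bullet> x) * (u \<times> y) $ i + (u \<bullet> y) * (x \<times> u) $ i + (u \<bullet> (x \<times> y)) * u $ i"
      using arg_cong[OF *, of "\<lambda>v. v $ i"] by simp
    then show "(x \<times> y - (2 * (u \<bullet> x)) *\<^sub>R (u \<times> y) - (2 * (u \<bullet> y)) *\<^sub>R (x \<times> u)) $ i
        = half_turn u (x \<times> y) $ i"
      by (simp add: half_turn_def)
  qed
  finally show ?thesis .
qed

lemma half_turn_sgn:
  assumes "norm u = 1"
  shows "half_turn u (sgn v) = sgn (half_turn u v)"
  by (simp add: sgn_div_norm half_turn_norm[OF assms] linear_cmul[OF linear_half_turn])

lemma det_half_turn:
  assumes "norm u = 1"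
  shows "det (vector [half_turn u x, half_turn u y, half_turn u z] :: real^3^3)
       = det (vector [x, y, z] :: real^3^3)"
  by (simp add: dot_cross_det[symmetric] half_turn_cross[OF assms] half_turn_inner[OF assms])

section \<open>Planes and coplanarity under the affine half-turn\<close>

text \<open>Splits the half-turn into an injective linear map followed by a translation, each of
  which preserves affine sets, dimension and coplanarity.\<close>

lemma image_rotation_about_pi:
  "rotation_about a u pi ` S = (\<lambda>x. (a - half_turn u a) + x) ` (half_turn u ` S)"
  by (auto simp: rotation_about_pi linear_diff[OF linear_half_turn] image_image)

lemma affine_plane_rotation_about_pi:
  assumes u: "norm u = 1" and P: "affine P" "aff_dim P = 2"
  shows "affine (rotation_about a u pi ` P)" "aff_dim (rotation_about a u pi ` P) = 2"
proof -
  have "half_turn u ` P = affine hull (half_turn u ` P)"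
    using affine_hull_linear_image[of "half_turn u" P] P(1) linear_half_turn
    by (simp add: linear_conv_bounded_linear affine_hull_eq[THEN iffD2])
  then have "affine (half_turn u ` P)" by (metis affine_affine_hull)
  then show "affine (rotation_about a u pi ` P)"
    unfolding image_rotation_about_pi by (simp only: affine_translation[symmetric])
  show "aff_dim (rotation_about a u pi ` P) = 2"
    unfolding image_rotation_about_pi
    by (simp add: aff_dim_translation_eq linear_half_turn inj_half_turn[OF u] P(2))
qed

lemma coplanar_rotation_about_pi:
  assumes u: "norm u = 1"
  shows "coplanar (rotation_about a u pi ` S) \<longleftrightarrow> coplanar S"
  unfolding image_rotation_about_pi
  by (simp add: coplanar_translation_eq coplanar_linear_image_eq linear_half_turn inj_half_turn[OF u])

section \<open>Gauss maps, and the mixed area under the half-turn\<close>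

lemma gauss_mapE:
  assumes "gauss_map D F N" "p \<in> D"
  obtains P where "norm (N p) = 1" "tangent_plane D F p P"
    "\<forall>x\<in>P. \<forall>y\<in>P. N p \<bullet> (x - y) = 0"
  using bspec[OF assms(1)[unfolded gauss_map_def] assms(2)] that by (elim conjE exE)

text \<open>An edge lies in the tangent planes at both of its endpoints, so it is orthogonal to each
  of the two normals separately. Hence the signs chosen for the normals do not matter here.\<close>

lemma gauss_map_edge_constraint:
  assumes g: "gauss_map D F N"
  shows "edge_constraint_net D F N"
proof -
  have sym: "p \<in> neighbours q" if "q \<in> neighbours p" for p q :: "int \<times> int"
    using that by (cases p; cases q) auto
  have *: "N p \<bullet> (F q - F p) = 0" if "p \<in> D" "q \<in> D" "q \<in> neighbours p" for p q
  proof -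
    obtain P where P: "tangent_plane D F p P" "\<forall>x\<in>P. \<forall>y\<in>P. N p \<bullet> (x - y) = 0"
      by (rule gauss_mapE[OF g \<open>p \<in> D\<close>]) (rule that)
    have "F p \<in> P" "F q \<in> P" using P(1) that unfolding tangent_plane_def by auto
    then show ?thesis using P(2) by blast
  qed
  have "(F q - F p) \<bullet> (N p + N q) = 0" if "p \<in> D" "q \<in> D" "q \<in> neighbours p" for p q
    using *[OF that] *[OF that(2,1) sym[OF that(3)]]
    by (simp add: inner_add_right inner_commute inner_diff_left inner_diff_right)
  then show ?thesis using g unfolding edge_constraint_net_def gauss_map_def by blast
qed

text \<open>
  The rotated quadrilateral is traversed as \<open>l, k, j, i\<close>, because the reflection of the index
  lattice turns its top edge into its bottom edge.
\<close>

lemma mixed_area_half_turn: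
  assumes u: "norm u = 1"
    and F: "\<And>p q. p \<in> D \<Longrightarrow> q \<in> D \<Longrightarrow> F' (s p) - F' (s q) = half_turn u (F p - F q)"
    and N: "\<And>p q. p \<in> D \<Longrightarrow> q \<in> D \<Longrightarrow> N' (s p) - N' (s q) = - half_turn u (N p - N q)"
    and D: "{i, j, k, l} \<subseteq> D"
  shows "(N' (s j) - N' (s l)) \<times> (N' (s i) - N' (s k))
       = - half_turn u ((N k - N i) \<times> (N l - N j))"
    and "mixed_area F' N' (sgn ((N' (s j) - N' (s l)) \<times> (N' (s i) - N' (s k)))) (s l) (s k) (s j) (s i)
       = - mixed_area F N (sgn ((N k - N i) \<times> (N l - N j))) i j k l"
proof -
  have minus: "half_turn u (- v) = - half_turn u v" for v
    by (rule linear_neg[OF linear_half_turn])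
  \<comment> \<open>Reversing a diagonal gives a sign; for the normals it cancels the minus in
    \<open>N\<close>, for the points it remains. It is kept inside \<open>half_turn u\<close> so
    that \<open>det_half_turn\<close> applies to every row.\<close>
  have 1: "N' (s j) - N' (s l) = half_turn u (N l - N j)" "N' (s i) - N' (s k) = half_turn u (N k - N i)"
    "F' (s j) - F' (s l) = half_turn u (- (F l - F j))" "F' (s i) - F' (s k) = half_turn u (- (F k - F i))"
    using D by (simp_all add: N F minus[symmetric])
  show *: "(N' (s j) - N' (s l)) \<times> (N' (s i) - N' (s k))
       = - half_turn u ((N k - N i) \<times> (N l - N j))"
    unfolding 1 half_turn_cross[OF u] minus[symmetric] by (simp add: cross_skew[of "N l - N j"])
  have \<nu>: "sgn (- half_turn u v) = half_turn u (- sgn v)" for v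
    by (simp add: half_turn_sgn[OF u] minus sgn_minus)
  \<comment> \<open>In each determinant the sign of the point diagonal cancels that of the
    direction. Interchanging the first two rows then yields the other summand of the original mixed
    area, at the cost of one minus sign.\<close>
  have det: "det (vector [- G, A, - v] :: real^3^3) + det (vector [B, - E, - v] :: real^3^3)
      = - (det (vector [E, B, v] :: real^3^3) + det (vector [A, G, v] :: real^3^3))"
    for A B E G v :: "real^3"
    by (simp add: det_3 algebra_simps)
  show "mixed_area F' N' (sgn ((N' (s j) - N' (s l)) \<times> (N' (s i) - N' (s k)))) (s l) (s k) (s j) (s i)
       = - mixed_area F N (sgn ((N k - N i) \<times> (N l - N j))) i j k l"
    unfolding mixed_area_def * unfolding \<nu> 1 det_half_turn[OF u] by (rule det)
qed

section \<open>The reflection of the index lattice\<close>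

definition reflect_row :: "int \<Rightarrow> int \<times> int \<Rightarrow> int \<times> int" where
  "reflect_row n0 p = (fst p, 2 * n0 - snd p)"

lemma reflect_row_Pair [simp]: "reflect_row n0 (m, n) = (m, 2 * n0 - n)"
  by (simp add: reflect_row_def)

text \<open>No unit square straddles the integer row \<open>n0\<close>: either its top edge is at
  height at most \<open>n0\<close>, or its bottom edge is at height at least \<open>n0\<close> and
  the square is the mirror image of one below, with top and bottom exchanged.\<close>

lemma elementary_quad_split_rows:
  assumes "elementary_quad UNIV i j k l"
  obtains "elementary_quad {(m, n). n \<le> n0} i j k l"
  | i' j' k' l' where "elementary_quad {(m, n). n \<le> n0} i' j' k' l'"
      "i = reflect_row n0 l'" "j = reflect_row n0 k'" "k = reflect_row n0 j'" "l = reflect_row n0 i'"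
proof -
  obtain m n where mn: "i = (m, n)" "j = (m + 1, n)" "k = (m + 1, n + 1)" "l = (m, n + 1)"
    using assms by (auto simp: elementary_quad_def)
  show thesis
  proof (cases "n < n0")
    case True
    then show thesis using that(1) by (auto simp: elementary_quad_def mn)
  next
    case False
    show thesis
      \<comment> \<open>The bottom row \<open>2 * n0 - n - 1\<close> of the preimage is the mirror
        of the top row \<open>n + 1\<close>.\<close>
      by (rule that(2)[of "(m, 2 * n0 - n - 1)" "(m + 1, 2 * n0 - n - 1)" "(m + 1, 2 * n0 - n)" "(m, 2 * n0 - n)"])
        (use False in \<open>auto simp: elementary_quad_def mn\<close>)
  qed
qed

lemma neighbours_reflect_row:
  "neighbours (reflect_row n0 p) = reflect_row n0 ` neighbours p"
  by (cases p) (auto simp: algebra_simps)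

section \<open>Gluing the net to its rotated copy along the line\<close>

theorem theorem3p11:
  fixes n0 :: int
    and D :: "(int \<times> int) set"
    and F N F' :: net
    and a u :: "real^3"
    and l :: "(real^3) set"
  assumes D: "D = {(m, n). n \<le> n0}"
    and minimal: "asymptotic_minimal_net D F N"
    and line: "norm u = 1" "l = {a + t *\<^sub>R u | t. True}"
    and on_line: "\<And>m. F (m, n0) \<in> l"
    and extends: "\<And>p. p \<in> D \<Longrightarrow> F' p = F p"
    and symmetric: "\<And>m k. k \<ge> 1 \<Longrightarrow> F' (m, n0 + k) = rotation_about a u pi (F' (m, n0 - k))"
  shows "\<exists>N'. (\<forall>p\<in>D. N' p = N p) \<and> asymptotic_minimal_net UNIV F' N'"
proof -
  define R where "R = rotation_about a u pi"
  define L where "L = half_turn u"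
  define S where "S = reflect_row n0"
  define N' where "N' p = (if p \<in> D then N p else - L (N (S p)))" for p
  have SS: "S (S p) = p" for p by (cases p) (simp add: S_def)
  have uu: "u \<bullet> u = 1" using line by (simp add: norm_eq_1)
  have anet: "asymptotic_net D F" and gauss: "gauss_map D F N"
    and mnet: "minimal_edge_constraint_net D F N"
    using minimal by (auto simp: asymptotic_minimal_net_def)
  have R_line: "R x = x" if "x \<in> l" for x
  proof -
    obtain t where t: "x = a + t *\<^sub>R u" using \<open>x \<in> l\<close> unfolding line by blast
    show ?thesis
      unfolding t by (simp add: R_def rotation_about_pi half_turn_def uu) (simp add: vec_eq_iff)
  qed
  have row: "p \<in> D \<Longrightarrow> S p \<in> D \<Longrightarrow> S p = p \<and> (\<exists>m. p = (m, n0))" for p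
    by (cases p) (auto simp: S_def D)
  \<comment> \<open>Combines \<open>extends\<close> and \<open>symmetric\<close> into one rule on
    all of \<open>D\<close>. The boundary row is the case \<open>k = 0\<close>, which
    \<open>symmetric\<close> leaves out; there both sides agree because \<open>R\<close> fixes
    \<open>l\<close> pointwise.\<close>
  have F'_S: "F' (S p) = R (F p)" if "p \<in> D" for p
  proof (cases "S p \<in> D")
    case True
    then show ?thesis using row[OF that] on_line R_line extends by auto
  next
    case False
    obtain m n where p: "p = (m, n)" by (cases p)
    have "F' (m, n0 + (n0 - n)) = R (F' (m, n0 - (n0 - n)))"
      using False that unfolding R_def by (intro symmetric) (auto simp: p S_def D)
    then show ?thesis using extends[OF that] by (simp add: p S_def)
  qed

  have row_plane: "N p \<bullet> u = 0 \<and> l \<subseteq> P"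
    if p: "p = (m, n0)" and P: "tangent_plane D F p P" and orth: "\<forall>x\<in>P. \<forall>y\<in>P. N p \<bullet> (x - y) = 0"
    for p m P
  proof -
    \<comment> \<open>The square just below the boundary edge: if the endpoints of that edge
      coincided, its vertices would be at most three points and hence coplanar.\<close>
    have "elementary_quad D (m, n0 - 1) (m + 1, n0 - 1) (m + 1, n0) (m, n0)"
      by (auto simp: elementary_quad_def D)
    then have "\<not> coplanar {F (m, n0 - 1), F (m + 1, n0 - 1), F (m + 1, n0), F (m, n0)}"
      using anet unfolding asymptotic_net_def by blast
    then have ne: "F (m + 1, n0) \<noteq> F (m, n0)" by (auto simp: coplanar_3)
    obtain s t where st: "F (m, n0) = a + s *\<^sub>R u" "F (m + 1, n0) = a + t *\<^sub>R u"
      using on_line[of m] on_line[of "m + 1"] unfolding line by auto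
    have inP: "F (m, n0) \<in> P" "F (m + 1, n0) \<in> P" and affP: "affine P"
      using P unfolding tangent_plane_def p by (auto simp: D)
    have "t \<noteq> s" using ne st by auto
    have "N p \<bullet> (F (m + 1, n0) - F (m, n0)) = 0" using orth inP by blast
    then have "N p \<bullet> ((t - s) *\<^sub>R u) = 0" unfolding st by (simp add: algebra_simps)
    then have "N p \<bullet> u = 0" using \<open>t \<noteq> s\<close> by simp
    moreover have "a + r *\<^sub>R u \<in> P" for r
    proof -
      \<comment> \<open>Affine parameter of the point \<open>a + r *\<^sub>R u\<close> relative to
        the two distinct points of the row, solving \<open>s + c * (t - s) = r\<close>.\<close>
      define c where "c = (r - s) / (t - s)"
      have c: "c * (t - s) = r - s" using \<open>t \<noteq> s\<close> by (simp add: c_def)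
      have "(1 - c) *\<^sub>R F (m, n0) + c *\<^sub>R F (m + 1, n0) \<in> P"
        using affP inP by (simp add: mem_affine)
      also have "(1 - c) *\<^sub>R F (m, n0) + c *\<^sub>R F (m + 1, n0) = a + (s + c * (t - s)) *\<^sub>R u"
        unfolding st by (simp add: algebra_simps)
      finally show ?thesis by (simp add: c)
    qed
    ultimately show ?thesis unfolding line by auto
  qed

  \<comment> \<open>On the boundary row \<open>S p = p\<close>, and the rule is consistent with
    \<open>N' p = N p\<close> because \<open>half_turn u\<close> negates vectors orthogonal to
    \<open>u\<close>.\<close>
  have N'_S: "N' (S p) = - L (N p)" if "p \<in> D" for p
  proof (cases "S p \<in> D")
    case True
    then obtain m where m: "p = (m, n0)" "S p = p" using row \<open>p \<in> D\<close> by blast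
    obtain P where "tangent_plane D F p P" "\<forall>x\<in>P. \<forall>y\<in>P. N p \<bullet> (x - y) = 0"
      by (rule gauss_mapE[OF gauss \<open>p \<in> D\<close>]) (rule that)
    then have "N p \<bullet> u = 0" using row_plane m by blast
    then show ?thesis using that m by (simp add: N'_def L_def half_turn_def inner_commute)
  next
    case False
    then show ?thesis by (simp add: N'_def SS)
  qed

  have gauss': "gauss_map UNIV F' N'"
    unfolding gauss_map_def
  proof (intro ballI)
    fix p :: "int \<times> int"
    \<comment> \<open>A vertex is on the boundary row, strictly below it, or the mirror image of one
      strictly below. Only in the first case does its star meet both halves.\<close>
    consider m where "p = (m, n0)" | "p \<in> D" "neighbours p \<subseteq> D" | q where "p = S q" "q \<in> D" "neighbours q \<subseteq> D"
    proof -
      obtain m n where p: "p = (m, n)" by (cases p)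
      consider "n = n0" | "n < n0" | "n > n0" by linarith
      then show thesis
      proof cases
        case 3
        show thesis by (rule that(3)[of "S p"]) (use 3 in \<open>auto simp: p S_def D\<close>)
      qed (use p that(1,2) in \<open>auto simp: D\<close>)
    qed
    then show "norm (N' p) = 1 \<and> (\<exists>P. tangent_plane UNIV F' p P \<and> (\<forall>x\<in>P. \<forall>y\<in>P. N' p \<bullet> (x - y) = 0))"
    proof cases
      case 1
      then have "p \<in> D" by (simp add: D)
      obtain P where n1: "norm (N p) = 1" and P: "tangent_plane D F p P"
        and orth: "\<forall>x\<in>P. \<forall>y\<in>P. N p \<bullet> (x - y) = 0"
        by (rule gauss_mapE[OF gauss \<open>p \<in> D\<close>]) (rule that)
      have lP: "l \<subseteq> P" using row_plane[OF 1 P orth] by simp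
      have affP: "affine P" using P by (simp add: tangent_plane_def)
      have RP: "R x \<in> P" if "x \<in> P" for x
      proof -
        \<comment> \<open>The foot of the perpendicular from \<open>x\<close> to \<open>l\<close>.
          Since it is the midpoint of \<open>x\<close> and \<open>R x\<close>, the point
          \<open>R x\<close> is an affine combination of it and \<open>x\<close> with weights 2 and
          -1.\<close>
        have "a + (u \<bullet> (x - a)) *\<^sub>R u \<in> P" using lP unfolding line by blast
        then have "2 *\<^sub>R (a + (u \<bullet> (x - a)) *\<^sub>R u) + (-1) *\<^sub>R x \<in> P"
          using affP that by (intro mem_affine) auto
        also have "2 *\<^sub>R (a + (u \<bullet> (x - a)) *\<^sub>R u) + (-1) *\<^sub>R x = R x"
          by (simp add: R_def rotation_about_pi half_turn_def scaleR_2 algebra_simps)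
        finally show ?thesis .
      qed
      have below: "F' q \<in> P" if "q \<in> D" "q \<in> insert p (neighbours p)" for q
        using P that extends unfolding tangent_plane_def by auto
      have "F' (m, n0 + 1) = R (F' (m, n0 - 1))" unfolding R_def by (rule symmetric) simp
      moreover have "F' (m, n0 - 1) \<in> P" by (rule below) (auto simp: 1 D)
      ultimately have above: "F' (m, n0 + 1) \<in> P" using RP by simp
      have "F' q \<in> P" if "q \<in> insert p (neighbours p)" for q
      proof (cases "q \<in> D")
        case True
        then show ?thesis using below that by simp
      next
        case False
        then have "q = (m, n0 + 1)" using that by (auto simp: 1 D)
        then show ?thesis using above by simp
      qed
      then have "tangent_plane UNIV F' p P"
        using P unfolding tangent_plane_def by auto
      then show ?thesis using n1 orth \<open>p \<in> D\<close> by (auto simp: N'_def)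
    next
      case 2
      have F'_eq: "F' ` ({p} \<union> neighbours p) = F ` ({p} \<union> neighbours p \<inter> D)"
        by (rule image_cong) (use 2 extends in auto)
      obtain P where "norm (N p) = 1" "tangent_plane D F p P"
        "\<forall>x\<in>P. \<forall>y\<in>P. N p \<bullet> (x - y) = 0"
        by (rule gauss_mapE[OF gauss 2(1)]) (rule that)
      moreover from this have "tangent_plane UNIV F' p P"
        using F'_eq unfolding tangent_plane_def by simp
      ultimately show ?thesis using 2 by (auto simp: N'_def)
    next
      case 3
      obtain P where n1: "norm (N q) = 1" and P: "tangent_plane D F q P"
        and orth: "\<forall>x\<in>P. \<forall>y\<in>P. N q \<bullet> (x - y) = 0"
        by (rule gauss_mapE[OF gauss 3(2)]) (rule that)
      have "F' ` ({p} \<union> neighbours p) = R ` F ` ({q} \<union> neighbours q)"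
      proof -
        have "{p} \<union> neighbours p = S ` ({q} \<union> neighbours q)"
          by (simp add: 3(1) S_def neighbours_reflect_row)
        moreover have "(\<lambda>q'. F' (S q')) ` ({q} \<union> neighbours q) = (\<lambda>q'. R (F q')) ` ({q} \<union> neighbours q)"
          by (rule image_cong[OF refl], rule F'_S) (use 3 in blast)
        ultimately show ?thesis by (simp only: image_image)
      qed
      moreover have "F ` ({q} \<union> neighbours q) \<subseteq> P"
        using P 3 unfolding tangent_plane_def by auto
      ultimately have "tangent_plane UNIV F' p (R ` P)"
        using P affine_plane_rotation_about_pi[OF line(1)]
        unfolding tangent_plane_def R_def by auto
      moreover have "N' p \<bullet> (x - y) = 0" if "x \<in> R ` P" "y \<in> R ` P" for x y
      proof -
        obtain x' y' where "x' \<in> P" "y' \<in> P" and xy: "x = R x'" "y = R y'"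
          using \<open>x \<in> R ` P\<close> \<open>y \<in> R ` P\<close> by blast
        then have "N q \<bullet> (x' - y') = 0" using orth by blast
        then show ?thesis
          unfolding xy R_def rotation_about_pi_diff 3(1) N'_S[OF 3(2)]
          by (simp add: L_def half_turn_inner[OF line(1)])
      qed
      moreover have "norm (N' p) = 1"
        using n1 by (simp add: 3(1) N'_S[OF 3(2)] L_def half_turn_norm[OF line(1)])
      ultimately show ?thesis by blast
    qed
  qed

  \<comment> \<open>Non-degeneracy and vanishing mixed area on the quadrilaterals\<close>
  have "\<not> coplanar {F' i, F' j, F' k, F' l} \<and>
      (N' k - N' i) \<times> (N' l - N' j) \<noteq> 0 \<and>
      mixed_area F' N' (sgn ((N' k - N' i) \<times> (N' l - N' j))) i j k l = 0"
    if "elementary_quad UNIV i j k l" for i j k l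
    using that
  proof (cases rule: elementary_quad_split_rows[where ?n0.0 = n0])
    case 1
    then have q: "elementary_quad D i j k l" by (simp add: D)
    then have "i \<in> D" "j \<in> D" "k \<in> D" "l \<in> D" by (auto simp: elementary_quad_def)
    then have "F' i = F i" "F' j = F j" "F' k = F k" "F' l = F l"
      "N' i = N i" "N' j = N j" "N' k = N k" "N' l = N l"
      by (simp_all add: extends N'_def)
    moreover have "\<not> coplanar {F i, F j, F k, F l}"
      using anet q unfolding asymptotic_net_def by blast
    moreover have "(N k - N i) \<times> (N l - N j) \<noteq> 0"
      "mixed_area F N (sgn ((N k - N i) \<times> (N l - N j))) i j k l = 0"
      using mnet q unfolding minimal_edge_constraint_net_def by blast+
    ultimately show ?thesis by (simp add: mixed_area_def)
  next
    case (2 i' j' k' l')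
    then have q: "elementary_quad D i' j' k' l'"
      and ijkl: "i = S l'" "j = S k'" "k = S j'" "l = S i'" by (simp_all add: D S_def)
    then have inD: "{i', j', k', l'} \<subseteq> D" by (auto simp: elementary_quad_def)
    have "\<not> coplanar {F i', F j', F k', F l'}" using anet q unfolding asymptotic_net_def by blast
    moreover have "{F' i, F' j, F' k, F' l} = R ` {F i', F j', F k', F l'}"
      using inD F'_S by (auto simp: ijkl)
    ultimately have noncoplanar: "\<not> coplanar {F' i, F' j, F' k, F' l}"
      by (simp only: R_def coplanar_rotation_about_pi[OF line(1)] not_False_eq_True)
    have min: "(N k' - N i') \<times> (N l' - N j') \<noteq> 0"
      "mixed_area F N (sgn ((N k' - N i') \<times> (N l' - N j'))) i' j' k' l' = 0"
      using mnet q unfolding minimal_edge_constraint_net_def by blast+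
    have dF: "F' (S p) - F' (S q) = half_turn u (F p - F q)" if "p \<in> D" "q \<in> D" for p q
      using that by (simp add: F'_S R_def rotation_about_pi_diff)
    have dN: "N' (S p) - N' (S q) = - half_turn u (N p - N q)" if "p \<in> D" "q \<in> D" for p q
      using that by (simp add: N'_S L_def linear_diff[OF linear_half_turn])
    have nonzero: "half_turn u v \<noteq> 0" if "v \<noteq> 0" for v
      using that half_turn_norm[OF line(1), of v] by auto
    \<comment> \<open>The cross product of the normal diagonals becomes minus its rotated image,
      nonzero since \<open>half_turn u\<close> is an isometry; the mixed area becomes minus
      zero.\<close>
    show ?thesis
      using mixed_area_half_turn[where s = S and F' = F' and N' = N' and F = F and N = N,
          OF line(1) dF dN inD] min noncoplanar nonzero[OF min(1)]
      unfolding ijkl by simp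
  qed
  \<comment> \<open>The planes that witness the Gauss map also witness planarity of the vertex
    stars.\<close>
  moreover have "\<exists>P. tangent_plane UNIV F' p P" for p
    by (rule gauss_mapE[OF gauss' UNIV_I]) (rule exI)
  ultimately have "asymptotic_minimal_net UNIV F' N'"
    using gauss' gauss_map_edge_constraint[OF gauss']
    unfolding asymptotic_minimal_net_def asymptotic_net_def minimal_edge_constraint_net_def
    by blast
  then show ?thesis by (intro exI[of _ N']) (simp add: N'_def)
qed

end
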